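(* Let $(z^j)_{j\ge0}$ be generated by the relaxed Peaceman-Rachford iteration with relaxation parameters $(\lambda_j)_{j\ge0}\subset(0,1]$ satisfying $\inf_{j\ge0}\lambda_j(1-\lambda_j)>0$, let $z^\ast$ be a fixed point of $T_{\mathrm{PRS}}$, and let $x^\ast=\mathbf{prox}_{\gamma g}(z^\ast)$. Let $\beta>0$. If $f$ (respectively $g$) is differentiable with $(1/\beta)$-Lipschitz gradient, and $x^k=x_g^k$ (respectively $x^k=x_f^k$) for all $k$, then $$\min_{i=0,\dots,k}\big\{f(x^i)+g(x^i)-f(x^\ast)-g(x^\ast)\big\}=o\Big(\frac1{k+1}\Big)\quad\text{as }k\to\infty.$$
   Context: $\mathcal H$ is a real Hilbert space; $f,g:\mathcal H\to(-\infty,\infty]$ are closed, proper, convex, and there is $x\in\mathcal H$ with $0\in\partial f(x)+\partial g(x)$. Fix an arbitrary $\gamma>0$. $\mathbf{prox}_{\gamma f}(x)=\arg\min_y f(y)+\frac1{2\gamma}\|y-x\|^2$, $\mathbf{refl}_{\gamma f}=2\,\mathbf{prox}_{\gamma f}-I$, $T_{\mathrm{PRS}}=\mathbf{refl}_{\gamma f}\circ\mathbf{refl}_{\gamma g}$. Differentiable means Fréchet differentiable on $\mathcal H$. Relaxed Peaceman-Rachford iteration: $z^0\in\mathcal H$ arbitrary, $z^{k+1}=(1-\lambda_k)z^k+\lambda_kT_{\mathrm{PRS}}z^k$. Auxiliary points: $x_g^k=\mathbf{prox}_{\gamma g}(z^k)$, $x_f^k=\mathbf{prox}_{\gamma f}(2x_g^k-z^k)$.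 *)

theory Defs
  imports "HOL-Analysis.Analysis" "HOL-Library.Landau_Symbols" "HOL-Library.Set_Algebras"
begin

definition ereal_epigraph :: "('a \<Rightarrow> ereal) \<Rightarrow> ('a \<times> real) set" where
  "ereal_epigraph f = {(x, r). f x \<le> ereal r}"

definition proper_fun :: "('a \<Rightarrow> ereal) \<Rightarrow> bool" where
  "proper_fun f \<longleftrightarrow> (\<forall>x. f x \<noteq> -\<infinity>) \<and> (\<exists>x. f x \<noteq> \<infinity>)"

definition closed_fun :: "('a::topological_space \<Rightarrow> ereal) \<Rightarrow> bool" where
  "closed_fun f \<longleftrightarrow> closed (ereal_epigraph f)"

definition convex_fun :: "('a::real_vector \<Rightarrow> ereal) \<Rightarrow> bool" where
  "convex_fun f \<longleftrightarrow> convex (ereal_epigraph f)"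

(* For proper f the set is empty at every point where f is infinite. *)
definition subdifferential :: "('a::real_inner \<Rightarrow> ereal) \<Rightarrow> 'a \<Rightarrow> 'a set" where
  "subdifferential f x = {u. \<forall>y. f x + ereal (inner u (y - x)) \<le> f y}"

(* The minimizer exists and is unique when f is closed, proper and convex, the space is
   complete and \<gamma> > 0, so the choice made by arg_min is then immaterial. *)
definition prox :: "real \<Rightarrow> ('a::real_inner \<Rightarrow> ereal) \<Rightarrow> 'a \<Rightarrow> 'a" where
  "prox \<gamma> f x = arg_min (\<lambda>y. f y + ereal (1 / (2 * \<gamma>) * (norm (y - x))\<^sup>2)) (\<lambda>y. True)"

definition refl_prox :: "real \<Rightarrow> ('a::real_inner \<Rightarrow> ereal) \<Rightarrow> 'a \<Rightarrow> 'a" where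
  "refl_prox \<gamma> f x = 2 *\<^sub>R prox \<gamma> f x - x"

definition T_PRS ::
  "real \<Rightarrow> ('a::real_inner \<Rightarrow> ereal) \<Rightarrow> ('a \<Rightarrow> ereal) \<Rightarrow> 'a \<Rightarrow> 'a" where
  "T_PRS \<gamma> f g = refl_prox \<gamma> f \<circ> refl_prox \<gamma> g"

(* Differentiability on the whole space includes that f is finite everywhere. GDERIV is
   Frechet differentiability together with the gradient vector, which is unique. *)
definition lipschitz_gradient :: "real \<Rightarrow> ('a::real_inner \<Rightarrow> ereal) \<Rightarrow> bool" where
  "lipschitz_gradient L f \<longleftrightarrow>
     (\<forall>x. \<bar>f x\<bar> \<noteq> \<infinity>) \<and>
     (\<exists>G. (\<forall>x. GDERIV (\<lambda>y. real_of_ereal (f y)) x :> G x) \<and> L-lipschitz_on UNIV G)"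

end

theory Submission
  imports Defs
begin

text \<open>
  Write \<open>d\<^sub>k = x\<^sub>g\<^sup>k - x\<^sub>f\<^sup>k\<close>, so that \<open>z\<^sup>k\<^sup>+\<^sup>1 = z\<^sup>k - 2 \<lambda>\<^sub>k d\<^sub>k\<close>. Monotonicity of the two
  subdifferentials gives \<open>\<parallel>d\<^sub>k\<parallel>\<^sup>2 \<le> d\<^sub>k \<bullet> (z\<^sup>k - z\<^sup>*)\<close>, hence both \<open>\<parallel>d\<^sub>k\<parallel>\<^sup>2\<close> and
  \<open>d\<^sub>k \<bullet> (z\<^sup>k - z\<^sup>*) - \<parallel>d\<^sub>k\<parallel>\<^sup>2\<close> are bounded by a constant times the decrease
  \<open>\<parallel>z\<^sup>k - z\<^sup>*\<parallel>\<^sup>2 - \<parallel>z\<^sup>k\<^sup>+\<^sup>1 - z\<^sup>*\<parallel>\<^sup>2\<close>. When one function is smooth, the objective gap is nonnegative and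
  bounded by a combination of these two quantities, so the gaps are summable, and the running minimum
  of a summable nonnegative sequence is \<open>o(1/(k+1))\<close>.
\<close>

section \<open>Running minima of summable sequences\<close>

text \<open>For \<open>k\<close> at least \<open>2 * N\<close> the block from \<open>N\<close> to
  \<open>k\<close> contains at least half of the first \<open>k + 1\<close> indices, and each of its
  terms dominates the running minimum. Hence \<open>(k + 1) / 2\<close> times the minimum is at most
  a Cauchy block of the series, which is arbitrarily small.\<close>

lemma summable_imp_Min_smallo:
  fixes a :: "nat \<Rightarrow> real"
  assumes nonneg: "\<And>i. 0 \<le> a i" and "summable a"
  shows "(\<lambda>k. MIN i\<in>{0..k}. a i) \<in> o(\<lambda>k. 1 / real (k + 1))"
proof (rule landau_o.smallI)
  fix c :: real
  assume "c > 0"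
  then obtain N where N: "\<And>m n. m \<ge> N \<Longrightarrow> norm (sum a {m..<n}) < c / 2"
    using \<open>summable a\<close> unfolding summable_Cauchy by (meson half_gt_zero)
  show "\<forall>\<^sub>F k in sequentially.
      norm (MIN i\<in>{0..k}. a i) \<le> c * norm (1 / real (k + 1))"
    using eventually_ge_at_top[of "2 * N"]
  proof eventually_elim
    case (elim k)
    define M where "M = (MIN i\<in>{0..k}. a i)"
    have M_le: "M \<le> a i" if "i \<le> k" for i
      unfolding M_def using that by (intro Min_le) auto
    have M_nonneg: "0 \<le> M"
      unfolding M_def by (intro Min.boundedI) (auto simp: nonneg)
    have "real (k + 1) / 2 * M \<le> real (k + 1 - N) * M"
      using elim M_nonneg by (intro mult_right_mono) (auto simp: of_nat_diff field_simps)
    also have "\<dots> = (\<Sum>i\<in>{N..<k + 1}. M)"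
      by simp
    also have "\<dots> \<le> sum a {N..<k + 1}"
      by (intro sum_mono M_le) auto
    also have "\<dots> < c / 2"
      using N[of N "k + 1"] by simp
    finally have "real (k + 1) * M \<le> c"
      by simp
    then have "M \<le> c / real (k + 1)"
      by (simp add: field_simps)
    then show ?case
      using M_nonneg by (simp flip: M_def)
  qed
qed

section \<open>Proximal points\<close>

text \<open>Supplies the at most linear descent that a quadratic term can absorb. Closedness gives a
  ball around a point one unit below the graph that misses the epigraph; convexity carries this
  local bound outwards along segments from \<open>p\<close>.\<close>

lemma closed_proper_convex_lower_bound:
  fixes f :: "'a::real_normed_vector \<Rightarrow> ereal"
  assumes "closed_fun f" "proper_fun f" "convex_fun f"
  obtains a b p where "b \<ge> 0" "\<And>y r. f y \<le> ereal r \<Longrightarrow> a - b * norm (y - p) \<le> r"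
proof -
  define E where "E = ereal_epigraph f"
  have inE: "(y, r) \<in> E \<longleftrightarrow> f y \<le> ereal r" for y r
    by (simp add: E_def ereal_epigraph_def)
  obtain p q where p: "f p = ereal q"
    using assms(2) unfolding proper_fun_def by (metis ereal_cases)
  have "closed E" "convex E"
    using assms by (simp_all add: E_def closed_fun_def convex_fun_def)
  have "(p, q - 1) \<in> - E"
    by (simp add: inE p)
  with \<open>closed E\<close> obtain e where e: "e > 0" "ball (p, q - 1) e \<subseteq> - E"
    by (metis open_Compl openE)
  have near: "q - 1 < r" if "(y, r) \<in> E" "norm (y - p) < e" for y r
  proof (rule ccontr)
    assume "\<not> q - 1 < r"
    with that(1) have "(y, q - 1) \<in> E"
      unfolding inE by (meson ereal_less_eq(3) not_less order_trans)
    moreover have "(y, q - 1) \<in> ball (p, q - 1) e"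
      using that(2) by (simp add: dist_Pair_Pair dist_norm norm_minus_commute)
    ultimately show False
      using e(2) by auto
  qed
  show thesis
  proof (rule that[of "2 / e" "q - 1" p])
    show "0 \<le> 2 / e"
      using e by simp
    fix y r
    assume "f y \<le> ereal r"
    then have yr: "(y, r) \<in> E"
      by (simp add: inE)
    show "q - 1 - 2 / e * norm (y - p) \<le> r"
    proof (cases "norm (y - p) < e")
      case True
      have "0 \<le> 2 / e * norm (y - p)"
        using e by simp
      with near[OF yr True] show ?thesis
        by linarith
    next
      case False
      \<comment> \<open>The point of the segment from \<open>p\<close> to \<open>y\<close> at
        distance \<open>e / 2\<close> from \<open>p\<close>, so \<open>near\<close> applies to it.
        Its conclusion \<open>t * (q - r) < 1\<close> yields the slope \<open>2 / e\<close>, since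
        \<open>1 / t\<close> is \<open>2 / e * norm (y - p)\<close>.\<close>
      define t where "t = e / (2 * norm (y - p))"
      have pos: "norm (y - p) > 0"
        using False e by linarith
      have t: "0 < t" "t \<le> 1"
        using False e pos by (simp_all add: t_def field_simps)
      have "(p, q) \<in> E"
        by (simp add: inE p)
      then have "(1 - t) *\<^sub>R (p, q) + t *\<^sub>R (y, r) \<in> E"
        using \<open>convex E\<close> yr t by (intro convexD_alt) auto
      then have "((1 - t) *\<^sub>R p + t *\<^sub>R y, (1 - t) * q + t * r) \<in> E"
        by simp
      moreover have "norm ((1 - t) *\<^sub>R p + t *\<^sub>R y - p) < e"
      proof -
        have "(1 - t) *\<^sub>R p + t *\<^sub>R y - p = t *\<^sub>R (y - p)"
          by (simp add: algebra_simps)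
        then show ?thesis
          using t e pos by (simp add: t_def)
      qed
      ultimately have "q - 1 < (1 - t) * q + t * r"
        by (rule near)
      then have "t * (q - r) < 1"
        by (simp add: algebra_simps)
      then have "q - r < 2 / e * norm (y - p)"
        using e pos by (simp add: t_def field_simps)
      then show ?thesis
        by linarith
    qed
  qed
qed

text \<open>Along a minimizing sequence the midpoints force the first components to be Cauchy, by the
  parallelogram law; the second components then converge as well.\<close>

lemma closed_convex_quadratic_minimizer:
  fixes E :: "('a::{real_inner, complete_space} \<times> real) set"
  assumes "closed E" "convex E" "E \<noteq> {}" "c > 0"
    and lower: "\<And>y r. (y, r) \<in> E \<Longrightarrow> m \<le> r + c * (norm (y - x))\<^sup>2"
  obtains y r where "(y, r) \<in> E"
    "\<And>w s. (w, s) \<in> E \<Longrightarrow> r + c * (norm (y - x))\<^sup>2 \<le> s + c * (norm (w - x))\<^sup>2"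
proof -
  \<comment> \<open>Minimizing over the epigraph instead of over points keeps the objective
    real-valued; closedness and convexity are then properties of the set \<open>E\<close>.\<close>
  define F where "F p = snd p + c * (norm (fst p - x))\<^sup>2" for p :: "'a \<times> real"
  define I where "I = Inf (F ` E)"
  have "bdd_below (F ` E)"
    by (rule bdd_belowI[of _ m]) (use lower in \<open>auto simp: F_def\<close>)
  then have I_le: "I \<le> F p" if "p \<in> E" for p
    unfolding I_def using that by (intro cInf_lower) auto
  have "\<exists>p\<in>E. F p < I + inverse (real (Suc n))" for n
  proof -
    have "Inf (F ` E) < I + inverse (real (Suc n))"
      by (simp add: I_def)
    then show ?thesis
      using cInf_lessD[of "F ` E"] \<open>E \<noteq> {}\<close> by auto
  qed
  then obtain P where P: "\<And>n. P n \<in> E" "\<And>n. F (P n) < I + inverse (real (Suc n))"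
    by metis
  have midpoint: "c / 2 * (norm (fst p - fst q))\<^sup>2 \<le> (F p - I) + (F q - I)"
    if "p \<in> E" "q \<in> E" for p q
  proof -
    have "(1 / 2) *\<^sub>R p + (1 / 2) *\<^sub>R q \<in> E"
      using \<open>convex E\<close> that by (intro convexD) auto
    then have "I \<le> F ((1 / 2) *\<^sub>R p + (1 / 2) *\<^sub>R q)"
      by (rule I_le)
    also have "\<dots> = (F p + F q) / 2 - c / 4 * (norm (fst p - fst q))\<^sup>2"
    proof -
      have eq: "(norm ((1 / 2) *\<^sub>R fst p + (1 / 2) *\<^sub>R fst q - x))\<^sup>2 =
          ((norm (fst p - x))\<^sup>2 + (norm (fst q - x))\<^sup>2) / 2 - (norm (fst p - fst q))\<^sup>2 / 4"
        unfolding power2_norm_eq_inner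
        by (simp add: inner_diff inner_add inner_commute field_simps)
      show ?thesis
        unfolding F_def fst_add snd_add fst_scaleR snd_scaleR eq by (simp add: field_simps)
    qed
    finally show ?thesis
      by (simp add: field_simps)
  qed
  have "Cauchy (\<lambda>n. fst (P n))"
  proof (rule metric_CauchyI)
    fix e :: real
    assume "e > 0"
    \<comment> \<open>Two excesses of at most this size add up to \<open>c / 2\<close> times the
      square of \<open>e\<close>, the scale of the left side of \<open>midpoint\<close>.\<close>
    then have "c * e\<^sup>2 / 4 > 0"
      using \<open>c > 0\<close> by simp
    then obtain N where N: "inverse (real (Suc N)) < c * e\<^sup>2 / 4"
      using reals_Archimedean by blast
    have "dist (fst (P m)) (fst (P n)) < e" if "m \<ge> N" "n \<ge> N" for m n
    proof -
      have small: "F (P k) - I < c * e\<^sup>2 / 4" if "k \<ge> N" for k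
      proof -
        have "inverse (real (Suc k)) \<le> inverse (real (Suc N))"
          using that by simp
        with P(2)[of k] N show ?thesis
          by linarith
      qed
      have "c / 2 * (norm (fst (P m) - fst (P n)))\<^sup>2 < c / 2 * e\<^sup>2"
        using midpoint[OF P(1) P(1), of m n] small[of m] small[of n] that by simp
      then have "(norm (fst (P m) - fst (P n)))\<^sup>2 < e\<^sup>2"
        using \<open>c > 0\<close> by simp
      then show ?thesis
        using \<open>e > 0\<close> by (simp add: dist_norm power_less_imp_less_base)
    qed
    then show "\<exists>M. \<forall>m\<ge>M. \<forall>n\<ge>M. dist (fst (P m)) (fst (P n)) < e"
      by blast
  qed
  then obtain y where y: "(\<lambda>n. fst (P n)) \<longlonglongrightarrow> y"
    using Cauchy_convergent convergent_def by blast
  have F_lim: "(\<lambda>n. F (P n)) \<longlonglongrightarrow> I"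
  proof (rule real_tendsto_sandwich)
    show "\<forall>\<^sub>F n in sequentially. I \<le> F (P n)"
      by (simp add: I_le P)
    show "\<forall>\<^sub>F n in sequentially. F (P n) \<le> I + inverse (real (Suc n))"
      using P(2) by (simp add: less_imp_le)
    show "(\<lambda>n. I + inverse (real (Suc n))) \<longlonglongrightarrow> I"
      using LIMSEQ_inverse_real_of_nat_add by blast
  qed simp
  \<comment> \<open>The only possible limit of the second components, as they equal
    \<open>F (P n)\<close> minus a convergent quadratic term. With this value
    \<open>F (y, r)\<close> is exactly the infimum \<open>I\<close>.\<close>
  define r where "r = I - c * (norm (y - x))\<^sup>2"
  have "(\<lambda>n. F (P n) - c * (norm (fst (P n) - x))\<^sup>2) \<longlonglongrightarrow> r"
    unfolding r_def by (intro tendsto_intros F_lim y)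
  then have "(\<lambda>n. snd (P n)) \<longlonglongrightarrow> r"
    by (simp add: F_def)
  with y have "(\<lambda>n. (fst (P n), snd (P n))) \<longlonglongrightarrow> (y, r)"
    by (rule tendsto_Pair)
  then have "P \<longlonglongrightarrow> (y, r)"
    by simp
  with \<open>closed E\<close> P(1) have "(y, r) \<in> E"
    by (rule closed_sequentially)
  moreover have "r + c * (norm (y - x))\<^sup>2 \<le> s + c * (norm (w - x))\<^sup>2" if "(w, s) \<in> E" for w s
    using I_le[OF that] by (simp add: r_def F_def)
  ultimately show thesis
    by (rule that)
qed

text \<open>\<open>arg_min\<close> is a choice operator, so its value is a minimizer only once some
  minimizer exists. Existence comes from the epigraph problem, which is bounded below because the
  quadratic dominates the linear descent of \<open>f\<close>.\<close>

lemma prox_minimizes: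
  fixes f :: "'a::{real_inner, complete_space} \<Rightarrow> ereal"
  assumes "closed_fun f" "proper_fun f" "convex_fun f" "\<gamma> > 0"
  shows "f (prox \<gamma> f x) + ereal (1 / (2 * \<gamma>) * (norm (prox \<gamma> f x - x))\<^sup>2)
    \<le> f w + ereal (1 / (2 * \<gamma>) * (norm (w - x))\<^sup>2)"
proof -
  define c where "c = 1 / (2 * \<gamma>)"
  define \<phi> where "\<phi> y = f y + ereal (c * (norm (y - x))\<^sup>2)" for y
  have "c > 0"
    using \<open>\<gamma> > 0\<close> by (simp add: c_def)
  obtain a b p where "b \<ge> 0" and lower: "\<And>y r. f y \<le> ereal r \<Longrightarrow> a - b * norm (y - p) \<le> r"
    using closed_proper_convex_lower_bound[OF assms(1-3)] by metis
  have bound: "a - b * norm (x - p) - b\<^sup>2 / (4 * c) \<le> r + c * (norm (y - x))\<^sup>2"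
    if "(y, r) \<in> ereal_epigraph f" for y r
  proof -
    \<comment> \<open>Completing the square in \<open>norm (y - x)\<close>; this is the source of
      the constant with denominator \<open>4 * c\<close>.\<close>
    have "0 \<le> c * (norm (y - x) - b / (2 * c))\<^sup>2"
      using \<open>c > 0\<close> by simp
    also have "\<dots> = c * (norm (y - x))\<^sup>2 - b * norm (y - x) + b\<^sup>2 / (4 * c)"
      using \<open>c > 0\<close> by (simp add: power2_eq_square field_simps)
    finally have quad: "b * norm (y - x) - b\<^sup>2 / (4 * c) \<le> c * (norm (y - x))\<^sup>2"
      by simp
    have "norm (y - p) \<le> norm (y - x) + norm (x - p)"
      by (metis norm_triangle_ineq diff_add_cancel add_diff_eq)
    then have "b * norm (y - p) \<le> b * norm (y - x) + b * norm (x - p)"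
      using \<open>b \<ge> 0\<close> by (metis distrib_left mult_left_mono)
    with lower[of y r] that quad show ?thesis
      by (simp add: ereal_epigraph_def)
  qed
  obtain p' where "f p' \<noteq> \<infinity>" "f p' \<noteq> - \<infinity>"
    using assms(2) unfolding proper_fun_def by blast
  then have "(p', real_of_ereal (f p')) \<in> ereal_epigraph f"
    by (cases "f p'") (auto simp: ereal_epigraph_def)
  then have "ereal_epigraph f \<noteq> {}"
    by blast
  then obtain y r where yr: "(y, r) \<in> ereal_epigraph f"
    "\<And>w s. (w, s) \<in> ereal_epigraph f \<Longrightarrow>
      r + c * (norm (y - x))\<^sup>2 \<le> s + c * (norm (w - x))\<^sup>2"
    using assms(1,3) \<open>c > 0\<close> bound
      closed_convex_quadratic_minimizer[of "ereal_epigraph f" c _ x]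
    unfolding closed_fun_def convex_fun_def by blast
  have "\<phi> y \<le> \<phi> w" for w
  proof (cases "f w")
    case (real s)
    have "\<phi> y \<le> ereal (r + c * (norm (y - x))\<^sup>2)"
      using yr(1) unfolding \<phi>_def by (auto simp: ereal_epigraph_def simp flip: plus_ereal.simps(1) intro: add_mono)
    also have "\<dots> \<le> \<phi> w"
      using yr(2)[of w s] real by (simp add: \<phi>_def ereal_epigraph_def)
    finally show ?thesis .
  qed (use assms(2) in \<open>auto simp: \<phi>_def proper_fun_def\<close>)
  then have "is_arg_min \<phi> (\<lambda>_. True) y"
    by (simp add: is_arg_min_linorder)
  then have "is_arg_min \<phi> (\<lambda>_. True) (arg_min \<phi> (\<lambda>_. True))"
    unfolding arg_min_def by (rule someI)
  moreover have "arg_min \<phi> (\<lambda>_. True) = prox \<gamma> f x"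
    by (simp add: prox_def \<phi>_def[abs_def] c_def)
  ultimately have "\<phi> (prox \<gamma> f x) \<le> \<phi> w"
    by (simp add: is_arg_min_linorder)
  then show ?thesis
    by (simp add: \<phi>_def c_def)
qed

lemma prox_finite:
  fixes f :: "'a::{real_inner, complete_space} \<Rightarrow> ereal"
  assumes "closed_fun f" "proper_fun f" "convex_fun f" "\<gamma> > 0"
  shows "\<bar>f (prox \<gamma> f x)\<bar> \<noteq> \<infinity>"
proof -
  obtain p where "f p \<noteq> \<infinity>"
    using assms(2) unfolding proper_fun_def by blast
  with prox_minimizes[OF assms, of x p] assms(2) show ?thesis
    unfolding proper_fun_def by (cases "f (prox \<gamma> f x)") auto
qed

text \<open>First-order optimality: the prox point is compared with points on the segment towards
  \<open>w\<close>, convexity bounds \<open>f\<close> there, and division by the step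
  \<open>t\<close> followed by \<open>t\<close> tending to 0 leaves the subgradient
  inequality.\<close>

lemma prox_subgradient:
  fixes f :: "'a::{real_inner, complete_space} \<Rightarrow> ereal"
  assumes "closed_fun f" "proper_fun f" "convex_fun f" "\<gamma> > 0"
  shows "(1 / \<gamma>) *\<^sub>R (x - prox \<gamma> f x) \<in> subdifferential f (prox \<gamma> f x)"
proof -
  define y where "y = prox \<gamma> f x"
  define c where "c = 1 / (2 * \<gamma>)"
  have "c > 0"
    using \<open>\<gamma> > 0\<close> by (simp add: c_def)
  obtain r where r: "f y = ereal r"
    using prox_finite[OF assms, of x] by (cases "f y") (auto simp: y_def)
  have "f y + ereal (inner ((1 / \<gamma>) *\<^sub>R (x - y)) (w - y)) \<le> f w" for w
  proof (cases "f w")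
    case (real s)
    define D where "D = (norm (w - y))\<^sup>2"
    have "D \<ge> 0"
      by (simp add: D_def)
    have step: "r - s \<le> 2 * c * inner (y - x) (w - y) + c * t * D" if t: "0 < t" "t < 1" for t
    proof -
      have "(1 - t) *\<^sub>R (y, r) + t *\<^sub>R (w, s) \<in> ereal_epigraph f"
        using assms(3) t r real unfolding convex_fun_def
        by (intro convexD_alt) (auto simp: ereal_epigraph_def)
      then have le: "f ((1 - t) *\<^sub>R y + t *\<^sub>R w) \<le> ereal ((1 - t) * r + t * s)"
        by (simp add: ereal_epigraph_def)
      have "ereal (r + c * (norm (y - x))\<^sup>2)
          \<le> f ((1 - t) *\<^sub>R y + t *\<^sub>R w) + ereal (c * (norm ((1 - t) *\<^sub>R y + t *\<^sub>R w - x))\<^sup>2)"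
        using prox_minimizes[OF assms, of x "(1 - t) *\<^sub>R y + t *\<^sub>R w"] r
        by (simp add: c_def flip: y_def)
      also have "\<dots> \<le> ereal ((1 - t) * r + t * s + c * (norm ((1 - t) *\<^sub>R y + t *\<^sub>R w - x))\<^sup>2)"
        using add_right_mono[OF le, of "ereal (c * (norm ((1 - t) *\<^sub>R y + t *\<^sub>R w - x))\<^sup>2)"]
        by simp
      finally have min: "r + c * (norm (y - x))\<^sup>2
          \<le> (1 - t) * r + t * s + c * (norm ((1 - t) *\<^sub>R y + t *\<^sub>R w - x))\<^sup>2"
        by simp
      have expand: "(norm ((1 - t) *\<^sub>R y + t *\<^sub>R w - x))\<^sup>2
          = (norm (y - x))\<^sup>2 + 2 * t * inner (y - x) (w - y) + t\<^sup>2 * D"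
      proof -
        have "(norm (a + t *\<^sub>R b))\<^sup>2 = (norm a)\<^sup>2 + 2 * t * inner a b + t\<^sup>2 * (norm b)\<^sup>2"
          for a b :: 'a
          unfolding power2_norm_eq_inner
          by (simp add: inner_add inner_commute power2_eq_square algebra_simps)
        moreover have "(1 - t) *\<^sub>R y + t *\<^sub>R w - x = (y - x) + t *\<^sub>R (w - y)"
          by (simp add: algebra_simps)
        ultimately show ?thesis
          by (simp only: D_def)
      qed
      have "t * (r - s) \<le> t * (2 * c * inner (y - x) (w - y) + c * t * D)"
        using min unfolding expand by (simp add: distrib_left left_diff_distrib right_diff_distrib
            power2_eq_square mult_ac)
      then show ?thesis
        using t by simp
    qed
    have "r - s \<le> 2 * c * inner (y - x) (w - y)"
    proof (rule field_le_epsilon)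
      fix e :: real
      assume "e > 0"
      \<comment> \<open>The bound \<open>1 / 2\<close> keeps \<open>t\<close> below 1, the other
        makes the remainder \<open>c * t * D\<close> at most \<open>e\<close>; adding 1 keeps the
        denominator positive when \<open>D\<close> is 0.\<close>
      define t where "t = min (1 / 2) (e / (c * D + 1))"
      have pos: "c * D + 1 > 0"
        using \<open>c > 0\<close> \<open>D \<ge> 0\<close> by (simp add: add_nonneg_pos)
      have t: "0 < t" "t < 1"
        using \<open>e > 0\<close> pos by (auto simp: t_def)
      have "c * D * t \<le> (c * D + 1) * t"
        using t by (simp add: algebra_simps)
      also have "\<dots> \<le> (c * D + 1) * (e / (c * D + 1))"
        using pos by (intro mult_left_mono) (auto simp: t_def)
      also have "\<dots> = e"
        using pos by simp
      finally have "c * D * t \<le> e" .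
      then have "c * t * D \<le> e"
        by (simp add: mult_ac)
      with step[OF t] show "r - s \<le> 2 * c * inner (y - x) (w - y) + e"
        by linarith
    qed
    moreover have "inner ((1 / \<gamma>) *\<^sub>R (x - y)) (w - y) = - (2 * c * inner (y - x) (w - y))"
      using \<open>\<gamma> > 0\<close> by (simp add: c_def inner_diff_left field_simps)
    ultimately show ?thesis
      using r real by simp
  qed (use assms(2) in \<open>auto simp: proper_fun_def\<close>)
  then show ?thesis
    by (simp add: subdifferential_def y_def)
qed

section \<open>Subgradients\<close>

lemma subdifferentialD_real:
  assumes "u \<in> subdifferential f a" "\<bar>f a\<bar> \<noteq> \<infinity>" "\<bar>f b\<bar> \<noteq> \<infinity>"
  shows "real_of_ereal (f a) + inner u (b - a) \<le> real_of_ereal (f b)"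
proof -
  have "f a + ereal (inner u (b - a)) \<le> f b"
    using assms(1) by (simp add: subdifferential_def)
  with assms(2,3) show ?thesis
    by (cases "f a"; cases "f b") auto
qed

lemma subdifferential_monotone:
  assumes "u \<in> subdifferential f a" "v \<in> subdifferential f b" "\<bar>f a\<bar> \<noteq> \<infinity>" "\<bar>f b\<bar> \<noteq> \<infinity>"
  shows "0 \<le> inner (u - v) (a - b)"
  using subdifferentialD_real[OF assms(1,3,4)] subdifferentialD_real[OF assms(2,4,3)]
  by (simp add: inner_diff_left inner_diff_right)

lemma convex_fun_real:
  assumes "convex_fun f" "\<And>x. \<bar>f x\<bar> \<noteq> \<infinity>"
  shows "convex_on UNIV (\<lambda>x. real_of_ereal (f x))"
proof
  fix t :: real and x y
  assume "0 < t" "t < 1"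
  have fin: "ereal (real_of_ereal (f x)) = f x" for x
    using assms(2) by (simp add: ereal_real')
  have "(1 - t) *\<^sub>R (x, real_of_ereal (f x)) + t *\<^sub>R (y, real_of_ereal (f y)) \<in> ereal_epigraph f"
    using assms(1) \<open>0 < t\<close> \<open>t < 1\<close> unfolding convex_fun_def
    by (intro convexD_alt) (auto simp: ereal_epigraph_def fin)
  then have "f ((1 - t) *\<^sub>R x + t *\<^sub>R y)
      \<le> ereal ((1 - t) * real_of_ereal (f x) + t * real_of_ereal (f y))"
    by (simp add: ereal_epigraph_def)
  then show "real_of_ereal (f ((1 - t) *\<^sub>R x + t *\<^sub>R y))
      \<le> (1 - t) * real_of_ereal (f x) + t * real_of_ereal (f y)"
    by (metis ereal_less_eq(3) fin)
qed simp

text \<open>Restriction to the line through \<open>x\<close> and \<open>y\<close> reduces the claim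
  to the tangent inequality for convex functions of one real variable.\<close>

lemma convex_on_gradient_ineq:
  fixes F :: "'a::real_inner \<Rightarrow> real"
  assumes "convex_on UNIV F" "GDERIV F x :> G"
  shows "F x + inner G (y - x) \<le> F y"
proof -
  define \<phi> where "\<phi> t = F (x + t *\<^sub>R (y - x))" for t :: real
  have "convex_on UNIV \<phi>"
  proof
    fix t a b :: real
    assume "0 < t" "t < 1"
    have "x + ((1 - t) *\<^sub>R a + t *\<^sub>R b) *\<^sub>R (y - x)
        = (1 - t) *\<^sub>R (x + a *\<^sub>R (y - x)) + t *\<^sub>R (x + b *\<^sub>R (y - x))"
      by (simp add: algebra_simps)
    then show "\<phi> ((1 - t) *\<^sub>R a + t *\<^sub>R b) \<le> (1 - t) * \<phi> a + t * \<phi> b"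
      using convex_onD[OF assms(1), of t] \<open>0 < t\<close> \<open>t < 1\<close> by (simp add: \<phi>_def)
  qed simp
  moreover have "(\<phi> has_field_derivative inner G (y - x)) (at 0)"
  proof -
    have "((\<lambda>t. x + t *\<^sub>R (y - x)) has_derivative (\<lambda>t. t *\<^sub>R (y - x))) (at 0)"
      by (auto intro!: derivative_eq_intros)
    moreover have "(F has_derivative (\<lambda>h. inner h G)) (at (x + 0 *\<^sub>R (y - x)))"
      using assms(2) by (simp add: gderiv_def)
    ultimately have "((\<lambda>t. F (x + t *\<^sub>R (y - x))) has_derivative
        (\<lambda>t. inner (t *\<^sub>R (y - x)) G)) (at 0)"
      by (rule has_derivative_compose)
    then show ?thesis
      by (simp add: \<phi>_def[abs_def] has_field_derivative_def inner_commute mult.commute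
          mult_commute_abs)
  qed
  ultimately have "inner G (y - x) * (1 - 0) \<le> \<phi> 1 - \<phi> 0"
    by (intro convex_on_imp_above_tangent[of UNIV]) auto
  then show ?thesis
    by (simp add: \<phi>_def)
qed

text \<open>Subtracting the linear functional of \<open>u\<close> from \<open>f\<close> gives a
  function minimal at \<open>x\<close>, so its derivative vanishes there; evaluating that derivative
  at \<open>G - u\<close> gives the claim.\<close>

lemma subgradient_eq_gradient:
  fixes f :: "'a::real_inner \<Rightarrow> ereal"
  assumes "\<And>x. \<bar>f x\<bar> \<noteq> \<infinity>" "GDERIV (\<lambda>y. real_of_ereal (f y)) x :> G"
    and "u \<in> subdifferential f x"
  shows "u = G"
proof -
  have "((\<lambda>y. real_of_ereal (f y) - inner y u) has_derivative (\<lambda>h. inner h G - inner h u)) (at x)"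
    using assms(2) unfolding gderiv_def by (auto intro!: derivative_eq_intros)
  moreover have "real_of_ereal (f x) - inner x u \<le> real_of_ereal (f y) - inner y u" for y
    using subdifferentialD_real[OF assms(3) assms(1) assms(1), of y]
    by (simp add: inner_diff_right inner_commute)
  ultimately have "(\<lambda>h. inner h G - inner h u) = (\<lambda>h. 0)"
    by (intro has_derivative_local_min) auto
  then have "inner (G - u) G - inner (G - u) u = 0"
    by metis
  then have "inner (G - u) (G - u) = 0"
    by (simp add: inner_diff_right)
  then show ?thesis
    by simp
qed

text \<open>The gradient inequality at \<open>a\<close> is evaluated at the auxiliary point \<open>c + (b - a)\<close>; this
  produces the cross term \<open>v \<bullet> (b - a)\<close>, with the subgradient at the reference point \<open>c\<close>
  instead of the one at \<open>a\<close>, and so makes the bound telescope along the iteration.\<close>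

lemma smooth_four_point:
  fixes f :: "'a::real_inner \<Rightarrow> ereal"
  assumes "convex_fun f" and smooth: "lipschitz_gradient L f"
    and u: "u \<in> subdifferential f a" and v: "v \<in> subdifferential f c"
  shows "real_of_ereal (f b) - real_of_ereal (f c)
    \<le> inner u (a - c) + inner v (b - a) + 2 * L * inner (b - a) (b - a)"
proof -
  define F where "F x = real_of_ereal (f x)" for x
  from smooth obtain G where fin: "\<And>x. \<bar>f x\<bar> \<noteq> \<infinity>"
    and G: "\<And>x. GDERIV F x :> G x" and L: "L-lipschitz_on UNIV G"
    unfolding lipschitz_gradient_def F_def[abs_def] by blast
  have "convex_on UNIV F"
    using convex_fun_real[OF assms(1) fin] by (simp add: F_def[abs_def])
  then have tangent: "F x + inner (G x) (y - x) \<le> F y" for x y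
    using G by (rule convex_on_gradient_ineq)
  \<comment> \<open>Convexity at \<open>y\<close> and the Lipschitz bound give the descent
    inequality with \<open>L\<close> in place of the sharp \<open>L / 2\<close>, without integrating
    along the segment. The constant does not affect summability.\<close>
  have descent: "F y \<le> F x + inner (G x) (y - x) + L * inner (y - x) (y - x)" for x y
  proof -
    have "F y \<le> F x + inner (G y) (y - x)"
      using tangent[of y x] by (simp add: inner_diff_right)
    also have "inner (G y) (y - x) = inner (G x) (y - x) + inner (G y - G x) (y - x)"
      by (simp add: inner_diff_left)
    also have "inner (G y - G x) (y - x) \<le> norm (G y - G x) * norm (y - x)"
      by (rule norm_cauchy_schwarz)
    also have "\<dots> \<le> (L * norm (y - x)) * norm (y - x)"
      using lipschitz_onD[OF L, of y x] by (intro mult_right_mono) (auto simp: dist_norm)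
    also have "\<dots> = L * inner (y - x) (y - x)"
      by (simp add: norm_eq_sqrt_inner)
    finally show ?thesis
      by simp
  qed
  have "u = G a" "v = G c"
    using subgradient_eq_gradient[of f] fin G u v unfolding F_def[abs_def] by blast+
  \<comment> \<open>Adding the three inequalities cancels \<open>F a\<close> and the value at the
    auxiliary point; the two \<open>u\<close> terms merge into
    \<open>inner u (a - c)\<close>.\<close>
  with tangent[of a "c + (b - a)"] descent[of "c + (b - a)" c] descent[of b a] show ?thesis
    unfolding F_def[symmetric]
    by (simp add: inner_diff_left inner_diff_right inner_add_left inner_add_right algebra_simps
        inner_commute)
qed

section \<open>The relaxed Peaceman-Rachford iteration\<close>

text \<open>The decrease splits into two nonnegative parts, with coefficients \<open>4 * t\<close>
  and \<open>4 * (t * (1 - t))\<close>. Both are at least \<open>4 * \<tau>\<close>, so either part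
  alone is controlled.\<close>

lemma relaxed_step_decrease:
  fixes d w :: "'a::real_inner"
  assumes "inner d d \<le> inner d w" "0 < t" "t \<le> 1" "\<tau> \<le> t * (1 - t)"
  shows "4 * \<tau> * inner d d \<le> (norm w)\<^sup>2 - (norm (w - (2 * t) *\<^sub>R d))\<^sup>2"
    and "4 * \<tau> * (inner d w - inner d d) \<le> (norm w)\<^sup>2 - (norm (w - (2 * t) *\<^sub>R d))\<^sup>2"
proof -
  have expand: "(norm w)\<^sup>2 - (norm (w - (2 * t) *\<^sub>R d))\<^sup>2
      = 4 * t * (inner d w - inner d d) + 4 * (t * (1 - t)) * inner d d"
    unfolding power2_norm_eq_inner
    by (simp add: inner_diff_left inner_diff_right inner_commute algebra_simps)
  have "t * (1 - t) \<le> t * 1"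
    using assms by (intro mult_left_mono) auto
  then have "\<tau> \<le> t"
    using assms by linarith
  then have "\<tau> * (inner d w - inner d d) \<le> t * (inner d w - inner d d)"
    using assms by (intro mult_right_mono) auto
  moreover have "0 \<le> t * (inner d w - inner d d)" "0 \<le> t * (1 - t) * inner d d"
    using assms by auto
  moreover have "\<tau> * inner d d \<le> t * (1 - t) * inner d d"
    using assms by (intro mult_right_mono) auto
  ultimately show "4 * \<tau> * inner d d \<le> (norm w)\<^sup>2 - (norm (w - (2 * t) *\<^sub>R d))\<^sup>2"
    and "4 * \<tau> * (inner d w - inner d d) \<le> (norm w)\<^sup>2 - (norm (w - (2 * t) *\<^sub>R d))\<^sup>2"
    unfolding expand by linarith+
qed

theorem theorem2:
  fixes f g :: "'a::{real_inner, complete_space} \<Rightarrow> ereal"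
    and \<gamma> \<beta> :: real
    and lam :: "nat \<Rightarrow> real"
    and z xg xf x :: "nat \<Rightarrow> 'a"
    and zstar xstar :: 'a
  assumes "closed_fun f" and "proper_fun f" and "convex_fun f"
    and "closed_fun g" and "proper_fun g" and "convex_fun g"
    and "\<exists>p. 0 \<in> subdifferential f p + subdifferential g p"
    and "\<gamma> > 0"
    and "\<And>j. lam j \<in> {0<..1}"
    and "(INF j. lam j * (1 - lam j)) > 0"
    and "\<And>k. z (Suc k) = (1 - lam k) *\<^sub>R z k + lam k *\<^sub>R T_PRS \<gamma> f g (z k)"
    and "\<And>k. xg k = prox \<gamma> g (z k)"
    and "\<And>k. xf k = prox \<gamma> f (2 *\<^sub>R xg k - z k)"
    and "T_PRS \<gamma> f g zstar = zstar"
    and "xstar = prox \<gamma> g zstar"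
    and "\<beta> > 0"
    and "(lipschitz_gradient (1 / \<beta>) f \<and> (\<forall>k. x k = xg k)) \<or>
         (lipschitz_gradient (1 / \<beta>) g \<and> (\<forall>k. x k = xf k))"
  shows "(\<forall>i. \<bar>f (x i) + g (x i) - f xstar - g xstar\<bar> \<noteq> \<infinity>) \<and>
    (\<lambda>k. MIN i\<in>{0..k}. real_of_ereal (f (x i) + g (x i) - f xstar - g xstar))
      \<in> o(\<lambda>k. 1 / real (k + 1))"
proof -
  note f_hyps = \<open>closed_fun f\<close> \<open>proper_fun f\<close> \<open>convex_fun f\<close> \<open>\<gamma> > 0\<close>
  note g_hyps = \<open>closed_fun g\<close> \<open>proper_fun g\<close> \<open>convex_fun g\<close> \<open>\<gamma> > 0\<close>
  have xg: "xg k = prox \<gamma> g (z k)" and xf: "xf k = prox \<gamma> f (2 *\<^sub>R xg k - z k)" for k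
    using assms by blast+
  have xs: "prox \<gamma> g zstar = xstar"
    using assms by blast
  \<comment> \<open>The fixed point equation makes \<open>xstar\<close> the prox point for both
    functions. The two resulting subgradients at \<open>xstar\<close> are therefore opposite,
    \<open>us\<close> for \<open>g\<close> and \<open>- us\<close> for \<open>f\<close>.\<close>
  have xs': "prox \<gamma> f (2 *\<^sub>R xstar - zstar) = xstar"
  proof -
    have "2 *\<^sub>R prox \<gamma> f (2 *\<^sub>R xstar - zstar) - (2 *\<^sub>R xstar - zstar) = zstar"
      using \<open>T_PRS \<gamma> f g zstar = zstar\<close> xs by (simp add: T_PRS_def refl_prox_def)
    then have "2 *\<^sub>R prox \<gamma> f (2 *\<^sub>R xstar - zstar) = 2 *\<^sub>R xstar"
      by (simp add: algebra_simps)
    then show ?thesis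
      by simp
  qed
  define uf where "uf k = (1 / \<gamma>) *\<^sub>R (2 *\<^sub>R xg k - z k - xf k)" for k
  define ug where "ug k = (1 / \<gamma>) *\<^sub>R (z k - xg k)" for k
  define us where "us = (1 / \<gamma>) *\<^sub>R (zstar - xstar)"
  define d where "d k = xg k - xf k" for k
  define w where "w k = z k - zstar" for k
  have uf: "uf k \<in> subdifferential f (xf k)" for k
    unfolding uf_def xf[of k] by (rule prox_subgradient[OF f_hyps])
  have ug: "ug k \<in> subdifferential g (xg k)" for k
    unfolding ug_def xg[of k] by (rule prox_subgradient[OF g_hyps])
  have us: "us \<in> subdifferential g xstar"
    using prox_subgradient[OF g_hyps, of zstar] by (simp add: us_def xs)
  have us': "- us \<in> subdifferential f xstar"
  proof -
    have "- us = (1 / \<gamma>) *\<^sub>R ((2 *\<^sub>R xstar - zstar) - xstar)"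
      by (simp add: us_def scaleR_2 flip: scaleR_minus_right)
    then show ?thesis
      using prox_subgradient[OF f_hyps, of "2 *\<^sub>R xstar - zstar"] by (simp only: xs')
  qed
  have fin: "\<bar>f (xf k)\<bar> \<noteq> \<infinity>" "\<bar>g (xg k)\<bar> \<noteq> \<infinity>" for k
    using prox_finite[OF f_hyps] prox_finite[OF g_hyps] xf xg by metis+
  have fin_star: "\<bar>f xstar\<bar> \<noteq> \<infinity>" "\<bar>g xstar\<bar> \<noteq> \<infinity>"
    using prox_finite[OF f_hyps] prox_finite[OF g_hyps] xs xs' by metis+

  \<comment> \<open>The left side is the sum of the two monotonicity products at \<open>xf k\<close>
    and \<open>xg k\<close> against \<open>xstar\<close>. The identity rests on
    \<open>uf k + ug k\<close> being \<open>d k\<close> scaled by \<open>1 / \<gamma>\<close>; the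
    same expression bounds the objective gap below.\<close>
  have S_eq: "inner (uf k) (xf k - xstar) + inner (ug k) (xg k - xstar) - inner us (d k)
      = (1 / \<gamma>) * (inner (d k) (w k) - inner (d k) (d k))" for k
    unfolding uf_def ug_def us_def d_def w_def
    by (simp add: inner_diff_left inner_diff_right inner_commute algebra_simps)
  have "0 \<le> (1 / \<gamma>) * (inner (d k) (w k) - inner (d k) (d k))" for k
  proof -
    have "0 \<le> inner (uf k - - us) (xf k - xstar)"
      using subdifferential_monotone[OF uf us' fin(1) fin_star(1)] .
    moreover have "0 \<le> inner (ug k - us) (xg k - xstar)"
      using subdifferential_monotone[OF ug us fin(2) fin_star(2)] .
    ultimately show ?thesis
      unfolding S_eq[symmetric] by (simp add: d_def inner_diff_left inner_diff_right inner_add_left)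
  qed
  then have mono: "inner (d k) (d k) \<le> inner (d k) (w k)" for k
    using \<open>\<gamma> > 0\<close> by (simp add: zero_le_divide_iff not_less)

  define \<tau> where "\<tau> = (INF j. lam j * (1 - lam j))"
  have lam: "0 < lam j" "lam j \<le> 1" for j
    using assms(9)[of j] by auto
  have "\<tau> > 0"
    using assms by (simp add: \<tau>_def)
  have \<tau>: "\<tau> \<le> lam j * (1 - lam j)" for j
  proof -
    \<comment> \<open>The infimum over the reals is a genuine lower bound only for a family bounded
      below; here 0 serves.\<close>
    have "bdd_below (range (\<lambda>j. lam j * (1 - lam j)))"
      by (rule bdd_belowI[of _ 0]) (use lam in \<open>auto simp: less_imp_le\<close>)
    then show ?thesis
      unfolding \<tau>_def by (rule cINF_lower) simp
  qed
  have w_Suc: "w (Suc k) = w k - (2 * lam k) *\<^sub>R d k" for k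
  proof -
    have "T_PRS \<gamma> f g (z k) = 2 *\<^sub>R xf k - (2 *\<^sub>R xg k - z k)"
      by (simp add: T_PRS_def refl_prox_def xf xg)
    then have "z (Suc k) = (1 - lam k) *\<^sub>R z k + lam k *\<^sub>R (2 *\<^sub>R xf k - (2 *\<^sub>R xg k - z k))"
      using assms(11)[of k] by simp
    then show ?thesis
      by (simp add: w_def d_def algebra_simps)
  qed
  define D where "D k = (norm (w k))\<^sup>2 - (norm (w (Suc k)))\<^sup>2" for k
  have D: "inner (d k) (d k) \<le> D k / (4 * \<tau>)"
    "inner (d k) (w k) - inner (d k) (d k) \<le> D k / (4 * \<tau>)" for k
    using relaxed_step_decrease[OF mono lam \<tau>] \<open>\<tau> > 0\<close>
    unfolding D_def w_Suc by (simp_all add: field_simps)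

  define h where "h k = real_of_ereal (f (x k)) + real_of_ereal (g (x k))
    - real_of_ereal (f xstar) - real_of_ereal (g xstar)" for k
  \<comment> \<open>In either case the smooth function is finite everywhere and the other one is
    evaluated at its own prox point.\<close>
  have fin_x: "\<bar>f (x k)\<bar> \<noteq> \<infinity>" "\<bar>g (x k)\<bar> \<noteq> \<infinity>" for k
    using assms(17) fin unfolding lipschitz_gradient_def by metis+
  \<comment> \<open>The opposite subgradients cancel on addition, so \<open>xstar\<close> minimizes
    \<open>f + g\<close>.\<close>
  have h_nonneg: "0 \<le> h k" for k
    using subdifferentialD_real[OF us fin_star(2) fin_x(2), of k]
      subdifferentialD_real[OF us' fin_star(1) fin_x(1), of k]
    by (simp add: h_def)
  have gap: "h k \<le> (1 / \<gamma>) * (inner (d k) (w k) - inner (d k) (d k)) + 2 / \<beta> * inner (d k) (d k)" for k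
    using assms(17)
  proof
    \<comment> \<open>The four-point bound is used with \<open>a\<close> as \<open>xf k\<close>,
      \<open>b\<close> as \<open>xg k\<close> and \<open>c\<close> as \<open>xstar\<close>, so that
      \<open>b - a\<close> is \<open>d k\<close>. Adding the subgradient inequality for
      \<open>g\<close> at \<open>xg k\<close> reproduces the left side of \<open>S_eq\<close>; the
      other case exchanges the roles and flips the sign of \<open>d k\<close>.\<close>
    assume H: "lipschitz_gradient (1 / \<beta>) f \<and> (\<forall>k. x k = xg k)"
    then have "real_of_ereal (f (xg k)) - real_of_ereal (f xstar)
        \<le> inner (uf k) (xf k - xstar) + inner (- us) (d k) + 2 * (1 / \<beta>) * inner (d k) (d k)"
      using smooth_four_point[OF \<open>convex_fun f\<close> _ uf us'] unfolding d_def by blast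
    moreover have "real_of_ereal (g (xg k)) + inner (ug k) (xstar - xg k) \<le> real_of_ereal (g xstar)"
      by (rule subdifferentialD_real[OF ug fin(2) fin_star(2)])
    ultimately show ?thesis
      using H unfolding S_eq[symmetric] h_def by (simp add: inner_diff_right)
  next
    assume H: "lipschitz_gradient (1 / \<beta>) g \<and> (\<forall>k. x k = xf k)"
    then have "real_of_ereal (g (xf k)) - real_of_ereal (g xstar)
        \<le> inner (ug k) (xg k - xstar) + inner us (xf k - xg k)
          + 2 * (1 / \<beta>) * inner (xf k - xg k) (xf k - xg k)"
      using smooth_four_point[OF \<open>convex_fun g\<close> _ ug us] by blast
    moreover have "xf k - xg k = - d k"
      by (simp add: d_def)
    moreover have "real_of_ereal (f (xf k)) + inner (uf k) (xstar - xf k) \<le> real_of_ereal (f xstar)"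
      by (rule subdifferentialD_real[OF uf fin(1) fin_star(1)])
    ultimately show ?thesis
      using H unfolding S_eq[symmetric] h_def by (simp add: inner_diff_right)
  qed
  \<comment> \<open>Collects the two coefficients in \<open>gap\<close>, each multiplied by the
    factor \<open>1 / (4 * \<tau>)\<close> from \<open>D\<close>.\<close>
  define C where "C = (1 / \<gamma> + 2 / \<beta>) / (4 * \<tau>)"
  have "C \<ge> 0"
    using \<open>\<gamma> > 0\<close> \<open>\<beta> > 0\<close> \<open>\<tau> > 0\<close> by (simp add: C_def)
  have h_le: "h k \<le> C * D k" for k
  proof -
    have "h k \<le> (1 / \<gamma>) * (D k / (4 * \<tau>)) + 2 / \<beta> * (D k / (4 * \<tau>))"
      using \<open>\<gamma> > 0\<close> \<open>\<beta> > 0\<close> by (intro order_trans[OF gap] add_mono mult_left_mono D) auto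
    also have "\<dots> = C * D k"
      by (simp add: C_def add_divide_distrib distrib_right)
    finally show ?thesis .
  qed
  have "summable h"
  proof (rule summableI_nonneg_bounded)
    fix n
    have "sum h {..<n} \<le> (\<Sum>k<n. C * D k)"
      by (intro sum_mono h_le)
    also have "\<dots> = C * ((norm (w 0))\<^sup>2 - (norm (w n))\<^sup>2)"
      unfolding D_def sum_distrib_left[symmetric]
      by (subst sum_lessThan_telescope'[of "\<lambda>k. (norm (w k))\<^sup>2"]) simp
    also have "\<dots> \<le> C * (norm (w 0))\<^sup>2"
      using \<open>C \<ge> 0\<close> by (intro mult_left_mono) auto
    finally show "sum h {..<n} \<le> C * (norm (w 0))\<^sup>2" .
  qed (rule h_nonneg)
  \<comment> \<open>Since all four values are finite, this one identity gives both conjuncts, and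
    \<open>real_of_ereal\<close> never falls back to its default 0 at an infinite gap.\<close>
  have gap_ereal: "f (x k) + g (x k) - f xstar - g xstar = ereal (h k)" for k
    using fin_x[of k] fin_star unfolding h_def
    by (cases "f (x k)"; cases "g (x k)"; cases "f xstar"; cases "g xstar") auto
  show ?thesis
    unfolding gap_ereal using summable_imp_Min_smallo[OF h_nonneg \<open>summable h\<close>] by simp
qed

end
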